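(* Let $G=(V,E)$ be a strongly regular graph with parameters $(n,d,\alpha,\beta)$. If the girth of $G$ is $5$, then the condensed Ricci curvature satisfies $$\Bbbk(x,y)=\frac{3}{d}-1$$ for all $xy\in E$.
   Context: A strongly regular graph with parameters $(n,d,\alpha,\beta)$ is a finite undirected simple graph with $n$ vertices, all of degree $d$, such that any two adjacent vertices have exactly $\alpha\ge 0$ common neighbors and any two distinct nonadjacent vertices have exactly $\beta\ge 1$ common neighbors. The girth of a graph is the length of its shortest cycle. Let $\rho$ be the shortest-path distance on $G$ and $\Gamma(x)=\{z\in V: xz\in E\}$. A probability measure on $G$ is a function $\mu:V\to[0,1]$ with $\sum_{v\in V}\mu(v)=1$. A transport plan between probability measures $\mu$ and $\nu$ is a function $\xi:V\times V\to[0,1]$ with $\sum_{w\in V}\xi(v,w)=\mu(v)$ for all $v\in V$ and $\sum_{v\in V}\xi(v,w)=\nu(w)$ for all $w\in V$. The transport ($L^1$-Wasserstein) distance is $W(\mu,\nu)=\inf_{\xi}\sum_{x\in V}\sum_{y\in V}\rho(x,y)\,\xi(x,y)$, the infimum being over all transport plans $\xi$ between $\mu$ and $\nu$. For $0\le\varepsilon\le 1$ and $x\in V$, let $m_x^{\varepsilon}$ be the probability measure with $m_x^{\varepsilon}(x)=1-\varepsilon$, $m_x^{\varepsilon}(y)=\frac{\varepsilon}{|\Gamma(x)|}$ for $y\in\Gamma(x)$, and $m_x^{\varepsilon}(y)=0$ otherwise. For distinct $x,y\in V$ set $\kappa_{\varepsilon}(x,y)=1-\frac{W(m_x^{\varepsilon},m_y^{\varepsilon})}{\rho(x,y)}$.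 The condensed Ricci curvature is $\Bbbk(x,y)=\lim_{\varepsilon\to 0^+}\frac{\kappa_{\varepsilon}(x,y)}{\varepsilon}$ (this limit is known to exist). *)

theory Defs
  imports
    "HOL-Analysis.Analysis"
    "Graph_Theory.Graph_Theory"
begin

text \<open>
  A finite undirected simple graph is an instance of the locale \<^locale>\<open>graph\<close> of
  \<open>Graph_Theory\<close>: a finite loop-free digraph without parallel arcs whose arc relation is
  symmetric. An undirected edge $xy$ is thus represented by the two arcs from $x$ to $y$ and
  from $y$ to $x$, and $xy \in E$ reads \<open>x \<rightarrow>\<^bsub>G\<^esub> y\<close>.
\<close>

definition nbrs :: "('a, 'b) pre_digraph \<Rightarrow> 'a \<Rightarrow> 'a set" where
  "nbrs G x = {z \<in> verts G. x \<rightarrow>\<^bsub>G\<^esub> z}"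

locale strongly_regular_graph = graph G
  for G :: "('a, 'b) pre_digraph" (structure) +
  fixes n d \<alpha> \<beta> :: nat
  assumes card_verts: "card (verts G) = n"
    and regular: "\<And>x. x \<in> verts G \<Longrightarrow> card (nbrs G x) = d"
    and adjacent: "\<And>x y. \<lbrakk>x \<in> verts G; y \<in> verts G; x \<rightarrow>\<^bsub>G\<^esub> y\<rbrakk>
          \<Longrightarrow> card (nbrs G x \<inter> nbrs G y) = \<alpha>"
    and nonadjacent: "\<And>x y. \<lbrakk>x \<in> verts G; y \<in> verts G; x \<noteq> y; \<not> x \<rightarrow>\<^bsub>G\<^esub> y\<rbrakk>
          \<Longrightarrow> card (nbrs G x \<inter> nbrs G y) = \<beta>"
    and beta_ge_1: "\<beta> \<ge> 1"

text \<open>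
  The directed cycles of length 2 run back and forth along one undirected edge and must be
  excluded. An acyclic graph has girth \<open>\<infinity>\<close>.
\<close>

definition girth :: "('a, 'b) pre_digraph \<Rightarrow> enat" where
  "girth G = (INF p \<in> {p. pre_digraph.cycle G p \<and> 3 \<le> length p}. enat (length p))"

text \<open>
  The weighted distance \<open>\<mu>\<close> of \<open>Graph_Theory\<close> with all weights 1. It is \<open>\<infinity>\<close> for vertices in
  different components, which \<^const>\<open>real_of_ereal\<close> sends to 0; strongly regular graphs are
  connected since \<open>\<beta> \<ge> 1\<close>.
\<close>

definition graph_dist :: "('a, 'b) pre_digraph \<Rightarrow> 'a \<Rightarrow> 'a \<Rightarrow> real" where
  "graph_dist G x y = real_of_ereal (wf_digraph.\<mu> G (\<lambda>_. 1) x y)"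

definition transport_plan ::
    "('a, 'b) pre_digraph \<Rightarrow> ('a \<Rightarrow> real) \<Rightarrow> ('a \<Rightarrow> real) \<Rightarrow> ('a \<Rightarrow> 'a \<Rightarrow> real) \<Rightarrow> bool" where
  "transport_plan G m m' \<xi> \<longleftrightarrow>
     (\<forall>v\<in>verts G. \<forall>w\<in>verts G. \<xi> v w \<in> {0..1}) \<and>
     (\<forall>v\<in>verts G. (\<Sum>w\<in>verts G. \<xi> v w) = m v) \<and>
     (\<forall>w\<in>verts G. (\<Sum>v\<in>verts G. \<xi> v w) = m' w)"

definition transport_dist ::
    "('a, 'b) pre_digraph \<Rightarrow> ('a \<Rightarrow> real) \<Rightarrow> ('a \<Rightarrow> real) \<Rightarrow> real" where
  "transport_dist G m m' =
     (INF \<xi> \<in> {\<xi>. transport_plan G m m' \<xi>}.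
        \<Sum>x\<in>verts G. \<Sum>y\<in>verts G. graph_dist G x y * \<xi> x y)"

definition lazy_measure :: "('a, 'b) pre_digraph \<Rightarrow> real \<Rightarrow> 'a \<Rightarrow> 'a \<Rightarrow> real" where
  "lazy_measure G \<epsilon> x y =
     (if y = x then 1 - \<epsilon>
      else if y \<in> nbrs G x then \<epsilon> / real (card (nbrs G x))
      else 0)"

definition ricci :: "('a, 'b) pre_digraph \<Rightarrow> real \<Rightarrow> 'a \<Rightarrow> 'a \<Rightarrow> real" where
  "ricci G \<epsilon> x y =
     1 - transport_dist G (lazy_measure G \<epsilon> x) (lazy_measure G \<epsilon> y) / graph_dist G x y"

definition condensed_ricci :: "('a, 'b) pre_digraph \<Rightarrow> 'a \<Rightarrow> 'a \<Rightarrow> real" where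
  "condensed_ricci G x y = Lim (at_right 0) (\<lambda>\<epsilon>. ricci G \<epsilon> x y / \<epsilon>)"

end

theory Submission
  imports Defs
begin

text \<open>
  Let \<open>xy\<close> be an edge and let \<open>X\<close>, \<open>Y\<close> be the remaining neighbours of \<open>x\<close> and \<open>y\<close>. Without
  cycles of length 3 or 4, \<open>X\<close> and \<open>Y\<close> are disjoint and no edge joins \<open>X\<close> to \<open>Y \<union> {y}\<close>; since
  \<open>\<beta> \<ge> 1\<close>, all distances between these two sets are exactly 2. Spreading the mass of \<open>X\<close> uniformly
  over \<open>Y\<close> and moving \<open>1 - \<epsilon> - \<epsilon>/d\<close> from \<open>x\<close> to \<open>y\<close> costs \<open>1 + \<epsilon> - 3\<epsilon>/d\<close>. This is optimal by weak
  duality, tested against the 1-Lipschitz function that is 2 on \<open>X\<close>, 0 on \<open>Y \<union> {y}\<close> and 1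
  elsewhere.
\<close>

section \<open>Adjacency and short cycles\<close>

lemma (in wf_digraph) adj_arcE:
  assumes "u \<rightarrow>\<^bsub>G\<^esub> v"
  obtains e where "e \<in> arcs G" "tail G e = u" "head G e = v" "u \<in> verts G" "v \<in> verts G"
  using assms adj_in_verts[OF assms] reachableE[OF assms] by metis

lemma (in sym_digraph) adj_sym: "u \<rightarrow>\<^bsub>G\<^esub> v \<Longrightarrow> v \<rightarrow>\<^bsub>G\<^esub> u"
  by (rule arcs_ends_symmetric[OF sym_arcs])

lemma girth_le: "pre_digraph.cycle G p \<Longrightarrow> 3 \<le> length p \<Longrightarrow> girth G \<le> enat (length p)"
  unfolding girth_def by (rule INF_lower) simp

text \<open>Without loops the three vertices are automatically distinct, so the three arcs form a
  genuine cycle.\<close>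

lemma (in loopfree_digraph) girth_le_3:
  assumes "a \<rightarrow>\<^bsub>G\<^esub> b" "b \<rightarrow>\<^bsub>G\<^esub> c" "c \<rightarrow>\<^bsub>G\<^esub> a"
  shows "girth G \<le> 3"
proof -
  obtain e1 where e1: "e1 \<in> arcs G" "tail G e1 = a" "head G e1 = b" "a \<in> verts G"
    using assms(1) by (rule adj_arcE)
  obtain e2 where e2: "e2 \<in> arcs G" "tail G e2 = b" "head G e2 = c" "b \<in> verts G"
    using assms(2) by (rule adj_arcE)
  obtain e3 where e3: "e3 \<in> arcs G" "tail G e3 = c" "head G e3 = a" "c \<in> verts G"
    using assms(3) by (rule adj_arcE)
  have "a \<noteq> b" "b \<noteq> c" "c \<noteq> a" using assms adj_not_same by auto
  with e1 e2 e3 have "cycle [e1, e2, e3]"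
    by (auto simp: cycle_def awalk_def)
  from girth_le[OF this] show ?thesis by (simp add: numeral_eq_enat eval_nat_numeral)
qed

text \<open>Absence of loops separates consecutive vertices only. The two opposite pairs must be
  assumed distinct, since otherwise the closed walk backtracks.\<close>

lemma (in loopfree_digraph) girth_le_4:
  assumes "a \<rightarrow>\<^bsub>G\<^esub> b" "b \<rightarrow>\<^bsub>G\<^esub> c" "c \<rightarrow>\<^bsub>G\<^esub> d" "d \<rightarrow>\<^bsub>G\<^esub> a" "a \<noteq> c" "b \<noteq> d"
  shows "girth G \<le> 4"
proof -
  obtain e1 where e1: "e1 \<in> arcs G" "tail G e1 = a" "head G e1 = b" "a \<in> verts G"
    using assms(1) by (rule adj_arcE)
  obtain e2 where e2: "e2 \<in> arcs G" "tail G e2 = b" "head G e2 = c" "b \<in> verts G"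
    using assms(2) by (rule adj_arcE)
  obtain e3 where e3: "e3 \<in> arcs G" "tail G e3 = c" "head G e3 = d" "c \<in> verts G"
    using assms(3) by (rule adj_arcE)
  obtain e4 where e4: "e4 \<in> arcs G" "tail G e4 = d" "head G e4 = a" "d \<in> verts G"
    using assms(4) by (rule adj_arcE)
  have "a \<noteq> b" "b \<noteq> c" "c \<noteq> d" "d \<noteq> a" using assms adj_not_same by auto
  with e1 e2 e3 e4 assms(5,6) have "cycle [e1, e2, e3, e4]"
    by (auto simp: cycle_def awalk_def)
  from girth_le[OF this] show ?thesis by (simp add: numeral_eq_enat eval_nat_numeral)
qed

section \<open>Graph distances 0, 1 and 2\<close>

lemma (in wf_digraph) awalk_cost_one: "awalk_cost (\<lambda>_. 1) p = real (length p)"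
  by (induction p) auto

lemma (in wf_digraph) graph_dist_nonneg: "0 \<le> graph_dist G u v"
  unfolding graph_dist_def \<mu>_def
  by (intro real_of_ereal_pos INF_greatest) (simp add: awalk_cost_one)

text \<open>A shortest walk attains the infimum defining \<open>\<mu>\<close>, which is therefore
  finite and survives the conversion to a real number.\<close>

lemma (in wf_digraph) graph_dist_eq_length:
  assumes "awalk u p v" "\<And>q. awalk u q v \<Longrightarrow> length p \<le> length q"
  shows "graph_dist G u v = length p"
proof -
  have "\<mu> (\<lambda>_. 1) u v = ereal (length p)"
    unfolding \<mu>_def
  proof (rule antisym)
    show "(INF q\<in>{q. awalk u q v}. ereal (awalk_cost (\<lambda>_. 1) q)) \<le> ereal (length p)"
      using assms(1) by (intro INF_lower2[of p]) (auto simp: awalk_cost_one)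
    show "ereal (length p) \<le> (INF q\<in>{q. awalk u q v}. ereal (awalk_cost (\<lambda>_. 1) q))"
      using assms(2) by (intro INF_greatest) (auto simp: awalk_cost_one)
  qed
  then show ?thesis by (simp add: graph_dist_def)
qed

lemma (in wf_digraph) graph_dist_self:
  assumes "u \<in> verts G"
  shows "graph_dist G u u = 0"
  using graph_dist_eq_length[of u "[]" u] assms by (simp add: awalk_Nil_iff)

lemma (in loopfree_digraph) graph_dist_adj:
  assumes "u \<rightarrow>\<^bsub>G\<^esub> v"
  shows "graph_dist G u v = 1"
proof -
  obtain e where e: "e \<in> arcs G" "tail G e = u" "head G e = v" "u \<in> verts G"
    using assms by (rule adj_arcE)
  have "u \<noteq> v" using assms adj_not_same by auto
  then have "1 \<le> length q" if "awalk u q v" for q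
    using that by (cases q) (auto simp: awalk_def)
  moreover have "awalk u [e] v" using e by (auto simp: awalk_def)
  ultimately show ?thesis using graph_dist_eq_length[of u "[e]" v] by simp
qed

lemma (in wf_digraph) graph_dist_two:
  assumes "u \<noteq> v" "\<not> u \<rightarrow>\<^bsub>G\<^esub> v" "u \<rightarrow>\<^bsub>G\<^esub> w" "w \<rightarrow>\<^bsub>G\<^esub> v"
  shows "graph_dist G u v = 2"
proof -
  obtain e where e: "e \<in> arcs G" "tail G e = u" "head G e = w" "u \<in> verts G"
    using assms(3) by (rule adj_arcE)
  obtain e' where e': "e' \<in> arcs G" "tail G e' = w" "head G e' = v" "w \<in> verts G"
    using assms(4) by (rule adj_arcE)
  \<comment> \<open>An empty walk would give \<open>u = v\<close>, and a single arc would make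
    \<open>u\<close> and \<open>v\<close> adjacent.\<close>
  have "length [e, e'] \<le> length q" if q: "awalk u q v" for q
  proof (rule ccontr)
    assume "\<not> length [e, e'] \<le> length q"
    then consider "q = []" | a where "q = [a]"
      by (cases q; cases "tl q") auto
    then show False
      using q assms(1,2) by cases (auto simp: awalk_def arcs_ends_conv)
  qed
  moreover have "awalk u [e, e'] v" using e e' by (auto simp: awalk_def)
  ultimately have "graph_dist G u v = length [e, e']" by (intro graph_dist_eq_length)
  then show ?thesis by simp
qed

text \<open>\<open>\<beta> \<ge> 1\<close> provides a common neighbour, hence a walk of length 2. In
  particular the diameter is at most 2.\<close>

lemma (in strongly_regular_graph) graph_dist_nonadj:
  assumes "u \<in> verts G" "v \<in> verts G" "u \<noteq> v" "\<not> u \<rightarrow>\<^bsub>G\<^esub> v"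
  shows "graph_dist G u v = 2"
proof -
  have "card (nbrs G u \<inter> nbrs G v) \<noteq> 0"
    using nonadjacent[OF assms] beta_ge_1 by simp
  then have "nbrs G u \<inter> nbrs G v \<noteq> {}" by force
  then obtain w where "u \<rightarrow>\<^bsub>G\<^esub> w" "v \<rightarrow>\<^bsub>G\<^esub> w" by (auto simp: nbrs_def)
  with assms graph_dist_two[of u v w] adj_sym[of v w] show ?thesis by simp
qed

section \<open>Bounds on the transport distance\<close>

lemma (in wf_digraph) transport_dist_le:
  assumes "transport_plan G m m' \<xi>"
  shows "transport_dist G m m' \<le> (\<Sum>x\<in>verts G. \<Sum>y\<in>verts G. graph_dist G x y * \<xi> x y)"
  unfolding transport_dist_def
proof (rule cINF_lower)
  show "bdd_below ((\<lambda>\<xi>. \<Sum>x\<in>verts G. \<Sum>y\<in>verts G. graph_dist G x y * \<xi> x y)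
          ` {\<xi>. transport_plan G m m' \<xi>})"
    by (rule bdd_belowI2[of _ 0])
       (auto simp: transport_plan_def graph_dist_nonneg intro!: sum_nonneg mult_nonneg_nonneg)
qed (use assms in simp)

text \<open>By the marginal conditions the left side is the integral of \<open>f u - f v\<close>
  against any plan, and the Lipschitz condition bounds it by the cost. The plan
  \<open>\<xi>0\<close> ensures that the real infimum is over a nonempty set.\<close>

lemma weak_kantorovich_duality:
  assumes "transport_plan G m m' \<xi>0"
    and lip: "\<And>u v. u \<in> verts G \<Longrightarrow> v \<in> verts G \<Longrightarrow> f u - f v \<le> graph_dist G u v"
  shows "(\<Sum>v\<in>verts G. f v * m v) - (\<Sum>v\<in>verts G. f v * m' v) \<le> transport_dist G m m'"
  unfolding transport_dist_def
proof (rule cINF_greatest)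
  fix \<xi> assume "\<xi> \<in> {\<xi>. transport_plan G m m' \<xi>}"
  then have \<xi>: "\<And>u v. u \<in> verts G \<Longrightarrow> v \<in> verts G \<Longrightarrow> 0 \<le> \<xi> u v"
      "\<And>u. u \<in> verts G \<Longrightarrow> m u = (\<Sum>v\<in>verts G. \<xi> u v)"
      "\<And>v. v \<in> verts G \<Longrightarrow> m' v = (\<Sum>u\<in>verts G. \<xi> u v)"
    by (auto simp: transport_plan_def)
  have "(\<Sum>v\<in>verts G. f v * m' v) = (\<Sum>u\<in>verts G. \<Sum>v\<in>verts G. f v * \<xi> u v)"
    by (subst sum.swap) (simp add: \<xi>(3) sum_distrib_left)
  then have "(\<Sum>v\<in>verts G. f v * m v) - (\<Sum>v\<in>verts G. f v * m' v)
      = (\<Sum>u\<in>verts G. \<Sum>v\<in>verts G. (f u - f v) * \<xi> u v)"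
    by (simp add: \<xi>(2) sum_distrib_left sum_subtractf left_diff_distrib)
  also have "\<dots> \<le> (\<Sum>u\<in>verts G. \<Sum>v\<in>verts G. graph_dist G u v * \<xi> u v)"
    by (intro sum_mono mult_right_mono lip \<xi>(1))
  finally show "(\<Sum>v\<in>verts G. f v * m v) - (\<Sum>v\<in>verts G. f v * m' v)
      \<le> (\<Sum>u\<in>verts G. \<Sum>v\<in>verts G. graph_dist G u v * \<xi> u v)" .
qed (use assms(1) in blast)

lemma (in strongly_regular_graph) sum_lazy_measure:
  fixes f :: "'a \<Rightarrow> real"
  assumes "x \<in> verts G"
  shows "(\<Sum>v\<in>verts G. f v * lazy_measure G \<epsilon> x v) = (1 - \<epsilon>) * f x + \<epsilon> / d * sum f (nbrs G x)"
proof -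
  \<comment> \<open>As \<open>x\<close> is not its own neighbour, the nested conditional is a sum of
    two weighted indicators, which can be summed separately.\<close>
  have "x \<notin> nbrs G x" using adj_not_same by (auto simp: nbrs_def)
  then have eq: "lazy_measure G \<epsilon> x v
      = (1 - \<epsilon>) * of_bool (v = x) + \<epsilon> / d * of_bool (v \<in> nbrs G x)" for v
    by (simp add: lazy_measure_def regular[OF assms])
  have "(\<Sum>v\<in>verts G. f v * lazy_measure G \<epsilon> x v)
      = (1 - \<epsilon>) * (\<Sum>v\<in>verts G. f v * of_bool (v = x))
        + \<epsilon> / d * (\<Sum>v\<in>verts G. f v * of_bool (v \<in> nbrs G x))"
    unfolding eq sum_distrib_left sum.distrib[symmetric]
    by (rule sum.cong) (auto simp: algebra_simps)
  also have "(\<Sum>v\<in>verts G. f v * of_bool (v = x)) = f x"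
    using assms by (simp add: of_bool_def if_distrib[of "\<lambda>c. _ * c"] cong: if_cong)
  also have "(\<Sum>v\<in>verts G. f v * of_bool (v \<in> nbrs G x)) = sum f (nbrs G x)"
    by (rule sum.mono_neutral_cong_right) (auto simp: nbrs_def)
  finally show ?thesis .
qed

section \<open>The exact transport distance across an edge\<close>

lemma (in strongly_regular_graph) transport_dist_lazy_measure:
  assumes girth: "girth G = 5"
    and xy: "x \<in> verts G" "y \<in> verts G" "x \<rightarrow>\<^bsub>G\<^esub> y"
    and \<epsilon>: "0 \<le> \<epsilon>" "\<epsilon> \<le> 1 / 2"
  shows "transport_dist G (lazy_measure G \<epsilon> x) (lazy_measure G \<epsilon> y) = 1 + \<epsilon> - 3 * \<epsilon> / d"
proof -
  define X where "X = nbrs G x - {y}"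
  define Y where "Y = nbrs G y - {x}"
  have yx: "y \<rightarrow>\<^bsub>G\<^esub> x" using xy adj_sym by blast
  have ne: "x \<noteq> y" using xy adj_not_same by auto
  have no3: False if "a \<rightarrow>\<^bsub>G\<^esub> b" "b \<rightarrow>\<^bsub>G\<^esub> c" "c \<rightarrow>\<^bsub>G\<^esub> a" for a b c
    using girth_le_3[OF that] girth by simp
  have no4: False if "a \<rightarrow>\<^bsub>G\<^esub> b" "b \<rightarrow>\<^bsub>G\<^esub> c" "c \<rightarrow>\<^bsub>G\<^esub> e" "e \<rightarrow>\<^bsub>G\<^esub> a" "a \<noteq> c" "b \<noteq> e" for a b c e
    using girth_le_4[OF that] girth by simp
  have fin: "finite X" "finite Y" by (auto simp: X_def Y_def nbrs_def)
  have sub: "X \<subseteq> verts G" "Y \<subseteq> verts G" by (auto simp: X_def Y_def nbrs_def)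
  have nX: "nbrs G x = insert y X" "y \<notin> X" "x \<notin> X"
    using xy adj_not_same by (auto simp: X_def nbrs_def)
  have nY: "nbrs G y = insert x Y" "x \<notin> Y" "y \<notin> Y"
    using xy yx adj_not_same by (auto simp: Y_def nbrs_def)
  have cX: "real (card X) = real d - 1"
    using regular[OF xy(1)] fin nX by auto
  have cY: "real (card Y) = real d - 1"
    using regular[OF xy(2)] fin nY by auto
  have d1: "1 \<le> d" using regular[OF xy(1)] fin nX by auto
  \<comment> \<open>A common element would form a triangle with the edge \<open>xy\<close>. In the
    next two facts the forbidden cycles are \<open>x, u, y\<close> and
    \<open>x, u, v, y\<close>.\<close>
  have disj: "X \<inter> Y = {}"
    using no3[of x _ y] yx adj_sym by (auto simp: X_def Y_def nbrs_def)
  have Xy: "\<not> u \<rightarrow>\<^bsub>G\<^esub> y" if "u \<in> X" for u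
    using no3[of x u y] yx that by (auto simp: X_def nbrs_def)
  have XY: "\<not> u \<rightarrow>\<^bsub>G\<^esub> v" if "u \<in> X" "v \<in> Y" for u v
    using no4[of x u v y] that yx ne adj_sym[of y v] by (auto simp: X_def Y_def nbrs_def)
  have dist2: "graph_dist G u v = 2" if "u \<in> X" "v \<in> insert y Y" for u v
    using that sub xy Xy XY disj nX by (intro graph_dist_nonadj) auto

  \<comment> \<open>Each vertex of \<open>X\<close> carries mass \<open>\<epsilon> / d\<close>,
    split equally among the \<open>d - 1\<close> vertices of \<open>Y\<close>. For
    \<open>d = 1\<close> both sets are empty and division by zero gives
    \<open>c = 0\<close>.\<close>
  define c where "c = \<epsilon> / d / (real d - 1)"
  have cpos: "0 \<le> c" using \<epsilon> d1 by (simp add: c_def)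
  have cd: "(real d - 1) * c = (if X = {} then 0 else \<epsilon> / d)"
    using cX fin by (auto simp: c_def)
  \<comment> \<open>Together with \<open>\<epsilon> \<le> 1 / 2\<close> this makes the mass
    \<open>1 - \<epsilon> - \<epsilon> / d\<close> sent from \<open>x\<close> to \<open>y\<close>
    nonnegative.\<close>
  have ed: "0 \<le> \<epsilon> / d" "\<epsilon> / d \<le> \<epsilon>"
    using \<epsilon> d1 mult_left_mono[of 1 "real d" \<epsilon>] by (auto simp: divide_le_eq)
  have Yempty: "Y = {} \<longleftrightarrow> X = {}" using cX cY fin by auto
  \<comment> \<open>The mass \<open>\<epsilon> / d\<close> common to both measures at
    \<open>x\<close> and at \<open>y\<close> stays in place; the excess at \<open>x\<close> fills
    the deficit at \<open>y\<close>.\<close>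
  define \<xi> where "\<xi> u v = \<epsilon> / d * of_bool (u = x \<and> v = x) + \<epsilon> / d * of_bool (u = y \<and> v = y)
      + (1 - \<epsilon> - \<epsilon> / d) * of_bool (u = x \<and> v = y) + c * of_bool (u \<in> X \<and> v \<in> Y)" for u v
  have s1: "(\<Sum>v\<in>verts G. g v * of_bool (P \<and> v = a)) = (if P then g a else 0)"
    if "a \<in> verts G" for P a and g :: "'a \<Rightarrow> real"
    using that by (simp add: of_bool_def if_distrib[of "\<lambda>c. _ * c"] cong: if_cong)
  have s2: "(\<Sum>v\<in>verts G. g v * of_bool (P \<and> v \<in> A)) = (if P then sum g A else 0)"
    if "A \<subseteq> verts G" for P A and g :: "'a \<Rightarrow> real"
  proof (cases P)
    case True
    have "(\<Sum>v\<in>verts G. g v * of_bool (v \<in> A)) = sum g A"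
      using that by (intro sum.mono_neutral_cong_right) auto
    with True show ?thesis by simp
  qed simp
  \<comment> \<open>The weight \<open>g\<close> serves two purposes: the constant 1 gives the first
    marginal, and \<open>graph_dist G u\<close> gives the cost of moving the mass at
    \<open>u\<close>.\<close>
  have row: "(\<Sum>v\<in>verts G. g v * \<xi> u v)
      = (if u = x then \<epsilon> / d * g x + (1 - \<epsilon> - \<epsilon> / d) * g y else 0)
        + (if u = y then \<epsilon> / d * g y else 0) + (if u \<in> X then c * sum g Y else 0)"
    for u and g :: "'a \<Rightarrow> real"
  proof -
    have "(\<Sum>v\<in>verts G. g v * \<xi> u v)
      = \<epsilon> / d * (\<Sum>v\<in>verts G. g v * of_bool (u = x \<and> v = x))
        + \<epsilon> / d * (\<Sum>v\<in>verts G. g v * of_bool (u = y \<and> v = y))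
        + (1 - \<epsilon> - \<epsilon> / d) * (\<Sum>v\<in>verts G. g v * of_bool (u = x \<and> v = y))
        + c * (\<Sum>v\<in>verts G. g v * of_bool (u \<in> X \<and> v \<in> Y))"
      unfolding \<xi>_def sum_distrib_left sum.distrib[symmetric]
      by (rule sum.cong) (auto simp: algebra_simps)
    then show ?thesis
      unfolding s1[OF xy(1)] s1[OF xy(2)] s2[OF sub(2)] by simp
  qed
  have col: "(\<Sum>u\<in>verts G. \<xi> u v)
      = (if v = x then \<epsilon> / d else 0) + (if v = y then \<epsilon> / d + (1 - \<epsilon> - \<epsilon> / d) else 0)
        + (if v \<in> Y then c * card X else 0)" for v
  proof -
    have "(\<Sum>u\<in>verts G. \<xi> u v)
      = \<epsilon> / d * (\<Sum>u\<in>verts G. 1 * of_bool (v = x \<and> u = x))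
        + \<epsilon> / d * (\<Sum>u\<in>verts G. 1 * of_bool (v = y \<and> u = y))
        + (1 - \<epsilon> - \<epsilon> / d) * (\<Sum>u\<in>verts G. 1 * of_bool (v = y \<and> u = x))
        + c * (\<Sum>u\<in>verts G. 1 * of_bool (v \<in> Y \<and> u \<in> X))"
      unfolding \<xi>_def sum_distrib_left sum.distrib[symmetric]
      by (rule sum.cong) (simp_all add: conj_commute)
    then show ?thesis
      unfolding s1[OF xy(1)] s1[OF xy(2)] s2[OF sub(1)] by simp
  qed
  \<comment> \<open>An element of \<open>X\<close> excludes the degenerate case
    \<open>d = 1\<close>.\<close>
  have cY': "c * card Y = \<epsilon> / d" if "u \<in> X" for u
    using cd cY that by (auto simp: mult.commute)
  have cX': "c * card X = \<epsilon> / d" if "v \<in> Y" for v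
    using cd cX Yempty that by (auto simp: mult.commute)
  have lx: "lazy_measure G \<epsilon> x u
      = (if u = x then 1 - \<epsilon> else if u = y \<or> u \<in> X then \<epsilon> / d else 0)" for u
    unfolding lazy_measure_def regular[OF xy(1)] by (simp add: nX(1))
  have ly: "lazy_measure G \<epsilon> y v
      = (if v = y then 1 - \<epsilon> else if v = x \<or> v \<in> Y then \<epsilon> / d else 0)" for v
    unfolding lazy_measure_def regular[OF xy(2)] by (simp add: nY(1))
  have rowsum: "(\<Sum>v\<in>verts G. \<xi> u v) = lazy_measure G \<epsilon> x u" for u
  proof -
    have "(\<Sum>v\<in>verts G. \<xi> u v)
      = (if u = x then \<epsilon> / d + (1 - \<epsilon> - \<epsilon> / d) else 0)
        + (if u = y then \<epsilon> / d else 0) + (if u \<in> X then c * card Y else 0)"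
      using row[of "\<lambda>_. 1" u] by simp
    also have "\<dots> = lazy_measure G \<epsilon> x u"
      unfolding lx using ne nX(2,3) cY'[of u]
      by (cases "u = x"; cases "u = y"; cases "u \<in> X"; simp)
    finally show ?thesis .
  qed
  have colsum: "(\<Sum>u\<in>verts G. \<xi> u v) = lazy_measure G \<epsilon> y v" for v
    unfolding ly col using ne nY(2,3) cX'[of v]
    by (cases "v = x"; cases "v = y"; cases "v \<in> Y"; simp)
  have \<xi>_nonneg: "0 \<le> \<xi> u v" for u v
    using cpos ed \<epsilon> by (auto simp: \<xi>_def)
  have \<xi>_le: "\<xi> u v \<le> 1" if "u \<in> verts G" "v \<in> verts G" for u v
  proof -
    \<comment> \<open>A nonnegative entry is at most its row sum, which is a value of the measure at
      \<open>x\<close>.\<close>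
    have "\<xi> u v \<le> (\<Sum>v\<in>verts G. \<xi> u v)"
      using that \<xi>_nonneg by (intro member_le_sum) auto
    also have "\<dots> \<le> 1"
      unfolding rowsum lx using \<epsilon> ed by simp
    finally show ?thesis .
  qed
  have plan: "transport_plan G (lazy_measure G \<epsilon> x) (lazy_measure G \<epsilon> y) \<xi>"
    using \<xi>_nonneg \<xi>_le rowsum colsum by (auto simp: transport_plan_def)

  \<comment> \<open>Mass that stays costs nothing, the move from \<open>x\<close> to
    \<open>y\<close> has length 1, and every move from \<open>X\<close> to \<open>Y\<close> has
    length 2.\<close>
  have rowcost: "(\<Sum>v\<in>verts G. graph_dist G u v * \<xi> u v)
      = (1 - \<epsilon> - \<epsilon> / d) * of_bool (u = x) + 2 * \<epsilon> / d * of_bool (u \<in> X)" for u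
  proof -
    have "(\<Sum>v\<in>verts G. graph_dist G u v * \<xi> u v)
      = (if u = x then 1 - \<epsilon> - \<epsilon> / d else 0) + (if u \<in> X then c * sum (graph_dist G u) Y else 0)"
      unfolding row using graph_dist_self xy(1,2) graph_dist_adj[OF xy(3)] by simp
    moreover have "c * sum (graph_dist G u) Y = 2 * \<epsilon> / d" if "u \<in> X"
      using cY'[OF that] dist2[OF that] by simp
    ultimately show ?thesis by simp
  qed
  have "(\<Sum>u\<in>verts G. \<Sum>v\<in>verts G. graph_dist G u v * \<xi> u v)
      = (1 - \<epsilon> - \<epsilon> / d) + 2 * \<epsilon> / d * (real d - 1)"
  proof -
    have at_x: "(\<Sum>u\<in>verts G. (1 - \<epsilon> - \<epsilon> / d) * of_bool (u = x)) = 1 - \<epsilon> - \<epsilon> / d"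
      using s1[OF xy(1), of "\<lambda>_. 1 - \<epsilon> - \<epsilon> / d" True] by (simp only: simp_thms if_True)
    have on_X: "(\<Sum>u\<in>verts G. 2 * \<epsilon> / d * of_bool (u \<in> X)) = (\<Sum>u\<in>X. 2 * \<epsilon> / d)"
      using s2[OF sub(1), of "\<lambda>_. 2 * \<epsilon> / d" True] by (simp only: simp_thms if_True)
    show ?thesis
      unfolding rowcost sum.distrib at_x on_X by (simp add: cX)
  qed
  also have "\<dots> = 1 + \<epsilon> - 3 * \<epsilon> / d"
    using d1 by (simp add: field_simps)
  finally have upper: "transport_dist G (lazy_measure G \<epsilon> x) (lazy_measure G \<epsilon> y)
      \<le> 1 + \<epsilon> - 3 * \<epsilon> / d"
    using transport_dist_le[OF plan] by simp

  \<comment> \<open>Complementary slackness dictates these values: \<open>f u - f v\<close> equals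
    the distance on every pair where \<open>\<xi>\<close> puts mass, so the dual value matches the
    cost.\<close>
  define f :: "'a \<Rightarrow> real" where "f v = (if v \<in> X then 2 else if v \<in> insert y Y then 0 else 1)" for v
  have lip: "f u - f v \<le> graph_dist G u v" if "u \<in> verts G" "v \<in> verts G" for u v
  proof -
    \<comment> \<open>A drop of 2 occurs only from \<open>X\<close> to \<open>insert y Y\<close>,
      where the distance is 2. For other pairs of distinct vertices a distance of at least 1
      suffices.\<close>
    have "f u - f v \<le> 1" if "\<not> (u \<in> X \<and> v \<in> insert y Y)"
      using that by (simp add: f_def)
    then consider "u = v" | "u \<in> X" "v \<in> insert y Y" | "u \<noteq> v" "f u - f v \<le> 1"
      by blast
    then show ?thesis
    proof cases
      case 2
      have "f u - f v \<le> 2" by (simp add: f_def)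
      with dist2[OF 2] show ?thesis by simp
    next
      case 3
      have "1 \<le> graph_dist G u v"
        using graph_dist_adj[of u v] graph_dist_nonadj[OF that 3(1)] by (cases "u \<rightarrow>\<^bsub>G\<^esub> v") auto
      with 3 show ?thesis by simp
    qed (use that graph_dist_self in simp)
  qed
  have fx: "f x = 1" "f y = 0" using ne nX nY by (auto simp: f_def)
  have "sum f X = (\<Sum>v\<in>X. 2)" by (rule sum.cong) (auto simp: f_def)
  then have sum_x: "sum f (nbrs G x) = 2 * (real d - 1)"
    using nX fin fx cX by simp
  have "sum f Y = 0"
    using disj by (intro sum.neutral) (auto simp: f_def)
  then have sum_y: "sum f (nbrs G y) = 1"
    using nY fin fx by simp
  have "(\<Sum>v\<in>verts G. f v * lazy_measure G \<epsilon> x v)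
      - (\<Sum>v\<in>verts G. f v * lazy_measure G \<epsilon> y v) = 1 + \<epsilon> - 3 * \<epsilon> / d"
    unfolding sum_lazy_measure[OF xy(1)] sum_lazy_measure[OF xy(2)] sum_x sum_y fx
    using d1 by (simp add: field_simps)
  with weak_kantorovich_duality[OF plan lip] upper show ?thesis by simp
qed

text \<open>\<open>Lim\<close> is a definite description, so its value is informative only with
  convergence; hence both are asserted. The transport distance is affine in
  \<open>\<epsilon>\<close> for small \<open>\<epsilon>\<close>, so the quotient is constant near
  0.\<close>

theorem theorem1p4:
  fixes G :: "('a, 'b) pre_digraph" and n d \<alpha> \<beta> :: nat
  assumes "strongly_regular_graph G n d \<alpha> \<beta>"
    and "girth G = 5"
  shows "\<forall>x\<in>verts G. \<forall>y\<in>verts G. x \<rightarrow>\<^bsub>G\<^esub> y \<longrightarrow>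
           ((\<lambda>\<epsilon>. ricci G \<epsilon> x y / \<epsilon>) \<longlongrightarrow> condensed_ricci G x y) (at_right 0) \<and>
           condensed_ricci G x y = 3 / real d - 1"
proof (intro ballI impI)
  fix x y assume xy: "x \<in> verts G" "y \<in> verts G" "x \<rightarrow>\<^bsub>G\<^esub> y"
  interpret strongly_regular_graph G n d \<alpha> \<beta> by fact
  have "ricci G \<epsilon> x y / \<epsilon> = 3 / real d - 1" if "0 < \<epsilon>" "\<epsilon> < 1 / 2" for \<epsilon>
    using that transport_dist_lazy_measure[OF assms(2) xy, of \<epsilon>]
    by (simp add: ricci_def graph_dist_adj[OF xy(3)] diff_divide_distrib)
  then have "\<forall>\<^sub>F \<epsilon> in at_right 0. ricci G \<epsilon> x y / \<epsilon> = 3 / real d - 1"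
    by (intro eventually_at_rightI[of 0 "1 / 2"]) auto
  then have lim: "((\<lambda>\<epsilon>. ricci G \<epsilon> x y / \<epsilon>) \<longlongrightarrow> 3 / real d - 1) (at_right 0)"
    by (rule tendsto_eventually)
  \<comment> \<open>The filter \<open>at_right 0\<close> is nontrivial, so the limit is unique and
    \<open>Lim\<close> returns it.\<close>
  then have "condensed_ricci G x y = 3 / real d - 1"
    unfolding condensed_ricci_def by (intro tendsto_Lim) auto
  with lim show "((\<lambda>\<epsilon>. ricci G \<epsilon> x y / \<epsilon>) \<longlongrightarrow> condensed_ricci G x y) (at_right 0) \<and>
      condensed_ricci G x y = 3 / real d - 1" by simp
qed

end
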